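(* Let $$B(x,y)=N(x+y)-N(x)-N(y)$$ be the polar bilinear form of the octonionic norm $N$, and, for the icosian double $G_0=\mathbb{I}\oplus\mathbb{I}\ell$, let $$G_0^\#=\{x\in K\otimes_{\mathbb{Z}[\varphi]}G_0:\ B(x,G_0)\subset\mathbb{Z}[\varphi]\}.$$ Then $G_0^\#=G_0$. Consequently $G_0$ has no strict norm-integral overorder obtained by adjoining a fractional ideal layer.
   Context: Let $\varphi=(1+\sqrt5)/2$, $K=\mathbb{Q}(\sqrt5)$. $\mathbb{H}(K)$ is the quaternion algebra over $K$ with basis $1,i,j,k$, $i^2=j^2=k^2=ijk=-1$, with standard conjugation. The icosian ring $\mathbb{I}\subset\mathbb{H}(K)$ is the free $\mathbb{Z}[\varphi]$-module with basis $$e_1=1,\quad e_2=i,\quad e_3=\tfrac12(1+i+j+k),\quad e_4=\tfrac12(-1+(\varphi-1)i-\varphi j).$$ $\mathbb{O}(K)=\mathbb{H}(K)\oplus\mathbb{H}(K)\ell=K\otimes_{\mathbb{Z}[\varphi]}G_0$ is the Cayley--Dickson double with product $(a+b\ell)(c+d\ell)=(ac-\overline{d}b)+(da+b\overline{c})\ell$, conjugation $\overline{a+b\ell}=\overline{a}-b\ell$, norm $N(x)=x\overline{x}$, and trace $\mathrm{Tr}(x)=x+\overline{x}$. A $\mathbb{Z}[\varphi]$-order in $\mathbb{O}(K)$ is a subset that is a finitely generated $\mathbb{Z}[\varphi]$-module, contains $1$, is closed under addition, multiplication and conjugation, and on which trace and norm take values in $\mathbb{Z}[\varphi]$. A strict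 norm-integral overorder of $G_0$ is an order of $\mathbb{O}(K)$ strictly containing $G_0$ whose elements all have norm in $\mathbb{Z}[\varphi]$ (not merely norm with integral rational trace). Adjoining a fractional ideal layer means enlarging $G_0$ by elements of $K\otimes_{\mathbb{Z}[\varphi]}G_0$ with denominators, as in $G_0+\tfrac12C$ with $C\subset G_0/2G_0$ or $G_0+\tfrac1{\sqrt5}C$ with $C\subset G_0/\sqrt5G_0$. *)

theory Defs
  imports Complex_Main
begin

section \<open>The field \<open>K = \<rat>(\<surd>5)\<close> and the ring \<open>\<int>[\<phi>]\<close>\<close>

typedef qsqrt5 = "{x :: real. \<exists>a b :: rat. x = of_rat a + of_rat b * sqrt 5}"
  morphisms real_of_qsqrt5 Abs_qsqrt5
  by blast

setup_lifting type_definition_qsqrt5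

lemma qsqrt5_norm_nonzero:
  fixes a b :: rat
  assumes "of_rat a + of_rat b * sqrt 5 \<noteq> (0::real)"
  shows "a\<^sup>2 - 5 * b\<^sup>2 \<noteq> 0"
proof
  assume "a\<^sup>2 - 5 * b\<^sup>2 = 0"
  then have eq: "a\<^sup>2 = 5 * b\<^sup>2" by simp
  show False
  proof (cases "b = 0")
    case True
    with eq assms show False by simp
  next
    case False
    obtain p q where pq: "a / b = of_int p / of_int q" "q > 0" "coprime p q"
      using quotient_of_div[of "a / b"] quotient_of_denom_pos[of "a / b"]
        quotient_of_coprime[of "a / b"] by (cases "quotient_of (a / b)") blast
    have "(a / b)\<^sup>2 = 5" using eq False by (simp add: power_divide)
    then have "(of_int p :: rat)\<^sup>2 = 5 * (of_int q)\<^sup>2"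
      using pq by (simp add: power_divide field_simps)
    then have i: "p\<^sup>2 = 5 * q\<^sup>2"
      by (metis of_int_eq_iff of_int_mult of_int_numeral of_int_power)
    have dvd5: "(5::int) dvd x" if "(5::int) dvd x\<^sup>2" for x
    proof -
      have "x mod 5 = 0 \<or> x mod 5 = 1 \<or> x mod 5 = 2 \<or> x mod 5 = 3 \<or> x mod 5 = 4" by presburger
      moreover have "(x mod 5)\<^sup>2 mod 5 = 0" using that by (simp add: power_mod dvd_eq_mod_eq_0)
      ultimately show ?thesis by (auto simp: dvd_eq_mod_eq_0)
    qed
    have "5 dvd p" by (rule dvd5) (simp add: i)
    then obtain r where "p = 5 * r" ..
    with i have "q\<^sup>2 = 5 * r\<^sup>2" by (simp add: power2_eq_square)
    then have "5 dvd q" by (metis dvd5 dvd_triv_left)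
    with \<open>5 dvd p\<close> pq(3) show False
      using coprime_common_divisor[of p q 5] by simp
  qed
qed

instantiation qsqrt5 :: field
begin

lift_definition zero_qsqrt5 :: qsqrt5 is 0
  by (rule exI[of _ 0], rule exI[of _ 0]) simp

lift_definition one_qsqrt5 :: qsqrt5 is 1
  by (rule exI[of _ 1], rule exI[of _ 0]) simp

lift_definition plus_qsqrt5 :: "qsqrt5 \<Rightarrow> qsqrt5 \<Rightarrow> qsqrt5" is "(+)"
proof clarify
  fix a b c d :: rat
  show "\<exists>u v. of_rat a + of_rat b * sqrt 5 + (of_rat c + of_rat d * sqrt 5)
      = of_rat u + of_rat v * sqrt 5"
    by (rule exI[of _ "a + c"], rule exI[of _ "b + d"]) (simp add: of_rat_add algebra_simps)
qed

lift_definition minus_qsqrt5 :: "qsqrt5 \<Rightarrow> qsqrt5 \<Rightarrow> qsqrt5" is "(-)"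
proof clarify
  fix a b c d :: rat
  show "\<exists>u v. of_rat a + of_rat b * sqrt 5 - (of_rat c + of_rat d * sqrt 5)
      = of_rat u + of_rat v * sqrt 5"
    by (rule exI[of _ "a - c"], rule exI[of _ "b - d"]) (simp add: of_rat_diff algebra_simps)
qed

lift_definition uminus_qsqrt5 :: "qsqrt5 \<Rightarrow> qsqrt5" is uminus
proof clarify
  fix a b :: rat
  show "\<exists>u v. - (of_rat a + of_rat b * sqrt 5) = of_rat u + of_rat v * sqrt 5"
    by (rule exI[of _ "- a"], rule exI[of _ "- b"]) (simp add: of_rat_minus)
qed

lift_definition times_qsqrt5 :: "qsqrt5 \<Rightarrow> qsqrt5 \<Rightarrow> qsqrt5" is "(*)"
proof clarify
  fix a b c d :: rat
  have "sqrt 5 * (sqrt 5 * x) = 5 * x" for x :: real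
    by (simp flip: mult.assoc)
  then show "\<exists>u v. (of_rat a + of_rat b * sqrt 5) * (of_rat c + of_rat d * sqrt 5)
      = of_rat u + of_rat v * sqrt 5"
    by (intro exI[of _ "a * c + 5 * b * d"] exI[of _ "a * d + b * c"])
       (simp add: of_rat_add of_rat_mult algebra_simps)
qed

lift_definition inverse_qsqrt5 :: "qsqrt5 \<Rightarrow> qsqrt5" is inverse
proof clarify
  fix a b :: rat
  let ?x = "of_rat a + of_rat b * sqrt 5 :: real"
  show "\<exists>u v. inverse ?x = of_rat u + of_rat v * sqrt 5"
  proof (cases "?x = 0")
    case True
    show ?thesis unfolding True by (rule exI[of _ 0], rule exI[of _ 0]) simp
  next
    case False
    define n where "n = a\<^sup>2 - 5 * b\<^sup>2"
    have n: "n \<noteq> 0" unfolding n_def using qsqrt5_norm_nonzero False by blast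
    have n': "(of_rat n :: real) \<noteq> 0" using n by simp
    have "?x * (of_rat a - of_rat b * sqrt 5) = of_rat n"
      by (simp add: n_def of_rat_diff of_rat_mult of_rat_power power2_eq_square algebra_simps)
    then have "?x * ((of_rat a - of_rat b * sqrt 5) / of_rat n) = 1"
      using n' by simp
    then have "inverse ?x = (of_rat a - of_rat b * sqrt 5) / of_rat n"
      by (rule inverse_unique)
    then show ?thesis
      by (intro exI[of _ "a / n"] exI[of _ "- b / n"])
         (simp add: of_rat_divide of_rat_minus diff_divide_distrib)
  qed
qed

definition divide_qsqrt5 :: "qsqrt5 \<Rightarrow> qsqrt5 \<Rightarrow> qsqrt5" where
  "divide_qsqrt5 x y = x * inverse y"

instance
  by standard (transfer; simp add: algebra_simps divide_qsqrt5_def | simp add: divide_qsqrt5_def)+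

end

lemma real_of_qsqrt5_of_nat: "real_of_qsqrt5 (of_nat n) = of_nat n"
  by (induction n) (simp_all add: zero_qsqrt5.rep_eq one_qsqrt5.rep_eq plus_qsqrt5.rep_eq)

lemma real_of_qsqrt5_of_int: "real_of_qsqrt5 (of_int n) = of_int n"
  by (cases n rule: int_cases2) (simp_all add: real_of_qsqrt5_of_nat uminus_qsqrt5.rep_eq)

instance qsqrt5 :: field_char_0
  by standard (metis injI of_nat_eq_iff real_of_qsqrt5_of_nat)

lift_definition sqrt5 :: qsqrt5 is "sqrt 5"
  by (rule exI[of _ 0], rule exI[of _ 1]) simp

definition phi :: qsqrt5 where
  "phi = (1 + sqrt5) / 2"

definition zphi :: "qsqrt5 set" where
  "zphi = {of_int a + of_int b * phi | a b. True}"


section \<open>Quaternions\<close>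

datatype 'a quat = Quat (qre: 'a) (qi: 'a) (qj: 'a) (qk: 'a)

instantiation quat :: (comm_ring_1) ring_1
begin

definition zero_quat :: "'a quat" where "0 = Quat 0 0 0 0"
definition one_quat :: "'a quat" where "1 = Quat 1 0 0 0"
definition plus_quat :: "'a quat \<Rightarrow> 'a quat \<Rightarrow> 'a quat" where
  "x + y = Quat (qre x + qre y) (qi x + qi y) (qj x + qj y) (qk x + qk y)"
definition minus_quat :: "'a quat \<Rightarrow> 'a quat \<Rightarrow> 'a quat" where
  "x - y = Quat (qre x - qre y) (qi x - qi y) (qj x - qj y) (qk x - qk y)"
definition uminus_quat :: "'a quat \<Rightarrow> 'a quat" where
  "- x = Quat (- qre x) (- qi x) (- qj x) (- qk x)"
definition times_quat :: "'a quat \<Rightarrow> 'a quat \<Rightarrow> 'a quat" where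
  "x * y = Quat
     (qre x * qre y - qi x * qi y - qj x * qj y - qk x * qk y)
     (qre x * qi y + qi x * qre y + qj x * qk y - qk x * qj y)
     (qre x * qj y - qi x * qk y + qj x * qre y + qk x * qi y)
     (qre x * qk y + qi x * qj y - qj x * qi y + qk x * qre y)"

instance
  by standard
    (simp_all add: zero_quat_def one_quat_def plus_quat_def minus_quat_def uminus_quat_def
      times_quat_def algebra_simps)

end

lemma quat_units:
  defines "i \<equiv> Quat 0 1 0 (0 :: 'a :: comm_ring_1)"
    and "j \<equiv> Quat 0 0 1 (0 :: 'a)" and "k \<equiv> Quat 0 0 0 (1 :: 'a)"
  shows "i * i = - 1" "j * j = - 1" "k * k = - 1" "i * j * k = - 1"
  by (simp_all add: i_def j_def k_def times_quat_def uminus_quat_def one_quat_def)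

definition qcnj :: "'a :: comm_ring_1 quat \<Rightarrow> 'a quat" where
  "qcnj x = Quat (qre x) (- qi x) (- qj x) (- qk x)"

definition qscale :: "'a :: comm_ring_1 \<Rightarrow> 'a quat \<Rightarrow> 'a quat" where
  "qscale c x = Quat (c * qre x) (c * qi x) (c * qj x) (c * qk x)"


section \<open>Octonions by Cayley--Dickson doubling\<close>

text \<open>\<open>Oct a b\<close> stands for \<open>a + b\<ell>\<close>.  The type \<open>qsqrt5 oct\<close> is all of \<open>\<O>(K)\<close>, so the ambient
  space \<open>K \<otimes> G\<^sub>0 = \<O>(K)\<close> is the universe of that type (see \<open>G0_denominator\<close> below).\<close>

datatype 'a oct = Oct (ofst: "'a quat") (osnd: "'a quat")

instantiation oct :: (comm_ring_1) "{ab_group_add, one, times}"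
begin

definition zero_oct :: "'a oct" where "0 = Oct 0 0"
definition one_oct :: "'a oct" where "1 = Oct 1 0"
definition plus_oct :: "'a oct \<Rightarrow> 'a oct \<Rightarrow> 'a oct" where
  "x + y = Oct (ofst x + ofst y) (osnd x + osnd y)"
definition minus_oct :: "'a oct \<Rightarrow> 'a oct \<Rightarrow> 'a oct" where
  "x - y = Oct (ofst x - ofst y) (osnd x - osnd y)"
definition uminus_oct :: "'a oct \<Rightarrow> 'a oct" where
  "- x = Oct (- ofst x) (- osnd x)"
definition times_oct :: "'a oct \<Rightarrow> 'a oct \<Rightarrow> 'a oct" where
  "x * y = Oct
     (ofst x * ofst y - qcnj (osnd y) * osnd x)
     (osnd y * ofst x + osnd x * qcnj (ofst y))"

instance
  by standard
    (simp_all add: zero_oct_def one_oct_def plus_oct_def minus_oct_def uminus_oct_def algebra_simps)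

end

definition ocnj :: "'a :: comm_ring_1 oct \<Rightarrow> 'a oct" where
  "ocnj x = Oct (qcnj (ofst x)) (- osnd x)"

definition oscale :: "'a :: comm_ring_1 \<Rightarrow> 'a oct \<Rightarrow> 'a oct" where
  "oscale c x = Oct (qscale c (ofst x)) (qscale c (osnd x))"

text \<open>Norm, trace and polar form are octonions lying in \<open>K \<cdot> 1\<close>; that they take values in
  \<open>\<int>[\<phi>]\<close> is expressed by membership in \<open>\<int>[\<phi>] \<cdot> 1\<close>.\<close>

definition onorm2 :: "'a :: comm_ring_1 oct \<Rightarrow> 'a oct" where
  "onorm2 x = x * ocnj x"

definition otrace :: "'a :: comm_ring_1 oct \<Rightarrow> 'a oct" where
  "otrace x = x + ocnj x"

definition opolar :: "'a :: comm_ring_1 oct \<Rightarrow> 'a oct \<Rightarrow> 'a oct" where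
  "opolar x y = onorm2 (x + y) - onorm2 x - onorm2 y"

definition zphi_oct :: "qsqrt5 oct set" where
  "zphi_oct = (\<lambda>c. oscale c 1) ` zphi"


section \<open>The icosian ring and its double\<close>

definition e1 :: "qsqrt5 quat" where "e1 = 1"
definition e2 :: "qsqrt5 quat" where "e2 = Quat 0 1 0 0"
definition e3 :: "qsqrt5 quat" where "e3 = qscale (1/2) (Quat 1 1 1 1)"
definition e4 :: "qsqrt5 quat" where "e4 = qscale (1/2) (Quat (- 1) (phi - 1) (- phi) 0)"

definition icosians :: "qsqrt5 quat set" where
  "icosians = {qscale a e1 + qscale b e2 + qscale c e3 + qscale d e4 | a b c d.
     a \<in> zphi \<and> b \<in> zphi \<and> c \<in> zphi \<and> d \<in> zphi}"

definition G0 :: "qsqrt5 oct set" where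
  "G0 = {Oct a b | a b. a \<in> icosians \<and> b \<in> icosians}"

definition polar_dual :: "qsqrt5 oct set \<Rightarrow> qsqrt5 oct set" where
  "polar_dual G = {x. \<forall>g\<in>G. opolar x g \<in> zphi_oct}"


section \<open>Orders and overorders\<close>

definition zphi_span :: "qsqrt5 oct set \<Rightarrow> qsqrt5 oct set" where
  "zphi_span S = {\<Sum>s\<in>T. oscale (c s) s | T c. finite T \<and> T \<subseteq> S \<and> c ` T \<subseteq> zphi}"

definition zphi_order :: "qsqrt5 oct set \<Rightarrow> bool" where
  "zphi_order M \<longleftrightarrow>
     (\<exists>S. finite S \<and> M = zphi_span S) \<and> 1 \<in> M \<and>
     (\<forall>x\<in>M. \<forall>y\<in>M. x + y \<in> M) \<and> (\<forall>x\<in>M. \<forall>y\<in>M. x * y \<in> M) \<and> (\<forall>x\<in>M. ocnj x \<in> M) \<and>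
     (\<forall>x\<in>M. otrace x \<in> zphi_oct \<and> onorm2 x \<in> zphi_oct)"

definition strict_norm_integral_overorder :: "qsqrt5 oct set \<Rightarrow> qsqrt5 oct set \<Rightarrow> bool" where
  "strict_norm_integral_overorder G M \<longleftrightarrow>
     zphi_order M \<and> G \<subset> M \<and> (\<forall>x\<in>M. onorm2 x \<in> zphi_oct)"

text \<open>\<open>M\<close> arises from \<open>G\<close> by adjoining a set \<open>S\<close> of elements having a denominator with respect to
  \<open>G\<close>; the layers \<open>G + 1/d C\<close> with \<open>C \<subseteq> G/dG\<close> a submodule (such as \<open>d = 2\<close> or \<open>d = \<surd>5\<close>) are the
  case \<open>S = {x. d x \<in> G, d x + d G \<in> C}\<close>.\<close>

definition adjoins_fractional_layer :: "qsqrt5 oct set \<Rightarrow> qsqrt5 oct set \<Rightarrow> bool" where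
  "adjoins_fractional_layer G M \<longleftrightarrow>
     (\<exists>S. (\<forall>x\<in>S. \<exists>d\<in>zphi. d \<noteq> 0 \<and> oscale d x \<in> G) \<and> M = zphi_span (G \<union> S))"

text \<open>The remaining lemmas show that every element of \<open>\<O>(K)\<close> has a denominator with respect to
  \<open>G\<^sub>0\<close>, that is, \<open>K \<otimes> G\<^sub>0 = \<O>(K)\<close>.\<close>

lemma zphi_phi_mult: "phi * phi = phi + 1"
proof -
  have "real_of_qsqrt5 (sqrt5 * sqrt5) = real_of_qsqrt5 5"
    using real_of_qsqrt5_of_nat[of 5] by (simp add: times_qsqrt5.rep_eq sqrt5.rep_eq)
  then have "sqrt5 * sqrt5 = 5" by (simp only: real_of_qsqrt5_inject)
  then show ?thesis by (simp add: phi_def field_simps)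
qed

lemma zphi_add: "x \<in> zphi \<Longrightarrow> y \<in> zphi \<Longrightarrow> x + y \<in> zphi"
proof -
  assume "x \<in> zphi" "y \<in> zphi"
  then obtain a b c d where "x = of_int a + of_int b * phi" "y = of_int c + of_int d * phi"
    by (auto simp: zphi_def)
  then have "x + y = of_int (a + c) + of_int (b + d) * phi" by (simp add: algebra_simps)
  then show ?thesis unfolding zphi_def by blast
qed

lemma zphi_mult: "x \<in> zphi \<Longrightarrow> y \<in> zphi \<Longrightarrow> x * y \<in> zphi"
proof -
  assume "x \<in> zphi" "y \<in> zphi"
  then obtain a b c d where "x = of_int a + of_int b * phi" "y = of_int c + of_int d * phi"
    by (auto simp: zphi_def)
  then have "x * y = of_int (a * c) + of_int (a * d + b * c) * phi + of_int (b * d) * (phi * phi)"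
    by (simp add: algebra_simps)
  then have "x * y = of_int (a * c + b * d) + of_int (a * d + b * c + b * d) * phi"
    by (simp add: zphi_phi_mult algebra_simps)
  then show ?thesis unfolding zphi_def by blast
qed

lemma zphi_of_int: "of_int n \<in> zphi"
  unfolding zphi_def by (rule CollectI, rule exI[of _ n], rule exI[of _ 0]) simp

lemma zphi_phi: "phi \<in> zphi"
  unfolding zphi_def by (rule CollectI, rule exI[of _ 0], rule exI[of _ 1]) simp

lemma zphi_numeral: "0 \<in> zphi" "1 \<in> zphi" "2 \<in> zphi" "- 1 \<in> zphi"
  using zphi_of_int[of 0] zphi_of_int[of 1] zphi_of_int[of 2] zphi_of_int[of "- 1"]
    by simp_all

lemma zphi_uminus: "x \<in> zphi \<Longrightarrow> - x \<in> zphi"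
  using zphi_mult[OF zphi_numeral(4)] by simp

lemma zphi_diff: "x \<in> zphi \<Longrightarrow> y \<in> zphi \<Longrightarrow> x - y \<in> zphi"
  using zphi_add[OF _ zphi_uminus] by fastforce

lemma qsqrt5_denominator: "\<exists>n :: int. n \<noteq> 0 \<and> of_int n * x \<in> zphi"
proof -
  obtain a b :: rat where ab: "real_of_qsqrt5 x = of_rat a + of_rat b * sqrt 5"
    using real_of_qsqrt5[of x] by blast
  obtain p q where a: "a = of_int p / of_int q" "q > 0"
    using quotient_of_div[of a] quotient_of_denom_pos[of a] by (cases "quotient_of a") blast
  obtain r s where b: "b = of_int r / of_int s" "s > 0"
    using quotient_of_div[of b] quotient_of_denom_pos[of b] by (cases "quotient_of b") blast
  have "of_rat a = (of_int p / of_int q :: real)" "of_rat b = (of_int r / of_int s :: real)"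
    by (simp_all add: a b of_rat_divide)
  then have "of_int (q * s) * real_of_qsqrt5 x = of_int (p * s) + of_int (q * r) * sqrt 5"
    using a(2) b(2) unfolding ab by (simp add: distrib_left)
  then have "real_of_qsqrt5 (of_int (q * s) * x)
      = real_of_qsqrt5 (of_int (p * s) + of_int (q * r) * sqrt5)"
    by (simp only: times_qsqrt5.rep_eq plus_qsqrt5.rep_eq real_of_qsqrt5_of_int sqrt5.rep_eq)
  then have "of_int (q * s) * x = of_int (p * s) + of_int (q * r) * sqrt5"
    by (simp only: real_of_qsqrt5_inject)
  also have "\<dots> = of_int (p * s - q * r) + of_int (2 * q * r) * phi"
    by (simp add: phi_def algebra_simps)
  finally have "of_int (q * s) * x \<in> zphi" unfolding zphi_def by blast
  moreover have "q * s \<noteq> 0" using a b by simp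
  ultimately show ?thesis by blast
qed

lemma icosians_Quat:
  assumes "a \<in> zphi" "b \<in> zphi" "c \<in> zphi" "d \<in> zphi"
  shows "Quat a b c d \<in> icosians"
proof -
  define u where "u = (1 - phi) * (c - d)"
  have u: "u \<in> zphi" unfolding u_def
    by (intro zphi_mult zphi_diff zphi_phi zphi_numeral assms)
  have "phi * u = (phi - phi * phi) * (c - d)" by (simp add: u_def algebra_simps)
  then have pu: "phi * u = d - c" by (simp add: zphi_phi_mult)
  have "Quat a b c d = qscale (a - d + u) e1 + qscale (b - d - (phi - 1) * u) e2
      + qscale (2 * d) e3 + qscale (2 * u) e4"
    using pu by (simp add: e1_def e2_def e3_def e4_def qscale_def plus_quat_def one_quat_def)
      (simp add: algebra_simps)
  moreover have "a - d + u \<in> zphi" "b - d - (phi - 1) * u \<in> zphi" "2 * d \<in> zphi" "2 * u \<in> zphi"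
    by (intro zphi_add zphi_mult zphi_diff zphi_phi zphi_numeral assms u)+
  ultimately show ?thesis unfolding icosians_def by blast
qed

lemma G0_denominator:
  "\<exists>d\<in>zphi. d \<noteq> 0 \<and> oscale d x \<in> G0"
proof -
  have ex: "\<exists>n :: int. n \<noteq> 0 \<and> (\<forall>y\<in>A. of_int n * y \<in> zphi)" if "finite A" for A
    using that
  proof induction
    case empty
    show ?case by (rule exI[of _ 1]) simp
  next
    case (insert z A)
    then obtain n :: int where n: "n \<noteq> 0" "\<forall>y\<in>A. of_int n * y \<in> zphi" by blast
    obtain m :: int where m: "m \<noteq> 0" "of_int m * z \<in> zphi" using qsqrt5_denominator by blast
    have "of_int (m * n) * y \<in> zphi" if "y \<in> A" for y
      using zphi_mult[OF zphi_of_int[of m]] n(2) that by (simp add: mult.assoc)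
    moreover have "of_int (m * n) * z \<in> zphi"
      using zphi_mult[OF zphi_of_int[of n] m(2)] by (simp add: algebra_simps)
    ultimately show ?case using n m by (intro exI[of _ "m * n"]) auto
  qed
  obtain a b c d a' b' c' d' where x: "x = Oct (Quat a b c d) (Quat a' b' c' d')"
    by (metis oct.exhaust quat.exhaust)
  obtain n :: int where n: "n \<noteq> 0" "\<forall>y\<in>{a, b, c, d, a', b', c', d'}. of_int n * y \<in> zphi"
    using ex[of "{a, b, c, d, a', b', c', d'}"] by blast
  then have "oscale (of_int n) x \<in> G0"
    unfolding x oscale_def qscale_def G0_def by (auto intro: icosians_Quat)
  then show ?thesis using n(1) by (intro bexI[of _ "of_int n"]) (simp_all add: zphi_of_int)
qed

end

(* The Gram matrix of e1, ..., e4 under the quaternionic polar form has entries in Z[phi] and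
   determinant phi^2, a unit, so the icosians, and with them the orthogonal sum G0, are self-dual.
   The norm being integral on an additively closed set M containing G0 forces the polar form to be
   integral on M, so M lies in the dual of G0, which is G0. *)
theory Submission
  imports Defs
begin

text \<open>The polar form of the quaternion norm in coordinates, equal to the trace of
  \<open>x * qcnj y\<close>. Unlike \<open>opolar\<close> it takes values in the scalars, so
  integrality is plain membership in \<open>zphi\<close>.\<close>

definition qpolar :: "'a :: comm_ring_1 quat \<Rightarrow> 'a quat \<Rightarrow> 'a" where
  "qpolar x y = 2 * (qre x * qre y + qi x * qi y + qj x * qj y + qk x * qk y)"

lemma onorm2_Oct:
  "onorm2 (Oct a b) = oscale ((qre a)\<^sup>2 + (qi a)\<^sup>2 + (qj a)\<^sup>2 + (qk a)\<^sup>2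
     + ((qre b)\<^sup>2 + (qi b)\<^sup>2 + (qj b)\<^sup>2 + (qk b)\<^sup>2)) 1"
  by (simp add: onorm2_def ocnj_def oscale_def qscale_def qcnj_def times_oct_def times_quat_def
      one_oct_def zero_quat_def one_quat_def minus_quat_def uminus_quat_def plus_quat_def
      power2_eq_square algebra_simps)

lemma oscale_one_diff: "oscale (c - d) 1 = oscale c 1 - oscale d 1"
  by (simp add: oscale_def qscale_def one_oct_def zero_quat_def one_quat_def minus_oct_def
      minus_quat_def)

lemma oscale_one_inject: "oscale c 1 = oscale d 1 \<longleftrightarrow> c = d"
  by (simp add: oscale_def qscale_def one_oct_def zero_quat_def one_quat_def)

text \<open>The octonion norm is the sum of the norms of the two halves, so the double is an
  orthogonal sum and each half can be treated separately.\<close>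

lemma opolar_Oct: "opolar (Oct a b) (Oct c d) = oscale (qpolar a c + qpolar b d) 1"
proof -
  have "Oct a b + Oct c d = Oct (a + c) (b + d)"
    by (simp add: plus_oct_def)
  then show ?thesis
    unfolding opolar_def by (simp only: onorm2_Oct flip: oscale_one_diff)
      (rule arg_cong[where f = "\<lambda>c. oscale c 1"],
       simp add: qpolar_def plus_quat_def power2_eq_square algebra_simps)
qed

lemma oscale_one_mem_zphi_oct_iff: "oscale c 1 \<in> zphi_oct \<longleftrightarrow> c \<in> zphi"
  by (auto simp: zphi_oct_def oscale_one_inject)

lemma zphi_oct_diff: "x \<in> zphi_oct \<Longrightarrow> y \<in> zphi_oct \<Longrightarrow> x - y \<in> zphi_oct"
  by (auto simp: zphi_oct_def zphi_diff simp flip: oscale_one_diff)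

lemma numeral_mem_zphi: "numeral n \<in> zphi"
  using zphi_of_int[of "numeral n"] by simp

lemmas zphi_intros = zphi_add zphi_diff zphi_uminus zphi_mult zphi_phi zphi_numeral
  numeral_mem_zphi

lemma qpolar_lincomb:
  "qpolar x (qscale a u + qscale b v + qscale c w + qscale d z)
     = a * qpolar x u + b * qpolar x v + c * qpolar x w + d * qpolar x z"
  by (simp add: qpolar_def plus_quat_def qscale_def algebra_simps)

lemma qpolar_commute: "qpolar x y = qpolar y x"
  by (simp add: qpolar_def mult.commute)

lemma qpolar_basis_mem_zphi:
  assumes "u \<in> {e1, e2, e3, e4}" "v \<in> {e1, e2, e3, e4}"
  shows "qpolar u v \<in> zphi"
proof -
  \<comment> \<open>The form of \<phi>^2 = \<phi> + 1 that matches inside right-associated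
    products.\<close>
  have sq: "phi * (phi * y) = phi * y + y" for y
    by (simp add: zphi_phi_mult distrib_right flip: mult.assoc)
  have "qpolar e1 e1 = 2" "qpolar e1 e2 = 0" "qpolar e1 e3 = 1" "qpolar e1 e4 = - 1"
    "qpolar e2 e2 = 2" "qpolar e2 e3 = 1" "qpolar e2 e4 = phi - 1"
    "qpolar e3 e3 = 2" "qpolar e3 e4 = - 1" "qpolar e4 e4 = 2"
    by (simp_all add: qpolar_def e1_def e2_def e3_def e4_def one_quat_def qscale_def
        field_simps zphi_phi_mult sq)
  then have "qpolar u v \<in> {2, 0, 1, - 1, phi - 1}"
    using assms qpolar_commute[of e2 e1] qpolar_commute[of e3 e1] qpolar_commute[of e4 e1]
      qpolar_commute[of e3 e2] qpolar_commute[of e4 e2] qpolar_commute[of e4 e3]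
    by auto
  then show ?thesis
    by (auto intro!: zphi_intros)
qed

lemma qpolar_icosians_mem_zphi:
  assumes "x \<in> icosians" "y \<in> icosians"
  shows "qpolar x y \<in> zphi"
proof -
  \<comment> \<open>Linearity in the second argument; with symmetry it serves twice, passing from
    the basis to the icosians in each argument in turn.\<close>
  have lincomb: "qpolar u z \<in> zphi"
    if "z \<in> icosians" and u: "\<And>e. e \<in> {e1, e2, e3, e4} \<Longrightarrow> qpolar u e \<in> zphi" for u z
  proof -
    obtain a b c d where z: "z = qscale a e1 + qscale b e2 + qscale c e3 + qscale d e4"
      and coeffs: "a \<in> zphi" "b \<in> zphi" "c \<in> zphi" "d \<in> zphi"
      using \<open>z \<in> icosians\<close> unfolding icosians_def by blast
    show ?thesis
      unfolding z qpolar_lincomb by (intro zphi_add zphi_mult coeffs u) simp_all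
  qed
  show ?thesis
    using assms lincomb qpolar_basis_mem_zphi by (metis qpolar_commute)
qed

text \<open>The pairings with the basis are the Gram matrix times the coordinates. As its
  determinant is a unit, the inverse is integral, and integral pairings force integral
  coordinates.\<close>

lemma mem_icosians_if_qpolar_basis:
  assumes "qpolar x e1 \<in> zphi" "qpolar x e2 \<in> zphi" "qpolar x e3 \<in> zphi" "qpolar x e4 \<in> zphi"
  shows "x \<in> icosians"
proof -
  obtain p q r s where x: "x = Quat p q r s"
    by (rule quat.exhaust)
  define v1 v2 v3 v4 where "v1 = 2 * p" and "v2 = 2 * q" and "v3 = p + q + r + s"
    and "v4 = (phi - 1) * q - p - phi * r"
  note v_defs = this
  have "v1 = qpolar x e1" "v2 = qpolar x e2" "v3 = qpolar x e3" "v4 = qpolar x e4"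
    by (simp_all add: x v_defs qpolar_def e1_def e2_def e3_def e4_def one_quat_def qscale_def
        field_simps)
  with assms have v: "v1 \<in> zphi" "v2 \<in> zphi" "v3 \<in> zphi" "v4 \<in> zphi"
    by simp_all
  have sq: "phi * (phi * y) = phi * y + y" for y
    by (simp add: zphi_phi_mult distrib_right flip: mult.assoc)
  \<comment> \<open>The rows of the inverse Gram matrix applied to the vector \<open>v\<close>, using \<open>1/\<phi> = \<phi> - 1\<close>.\<close>
  define a where "a = (4 - 2 * phi) * v1 + (5 - 3 * phi) * v2 + (phi - 2) * v3 + (5 - 3 * phi) * v4"
  define b where "b = (5 - 3 * phi) * v1 + (8 - 4 * phi) * v2 + (phi - 3) * v3 + (7 - 5 * phi) * v4"
  define t where "t = (phi - 1) * ((phi - 1) * v2 - v1 - 2 * v4)"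
  define c where "c = 2 * v3 - v1 - v2 - t"
  define d where "d = (phi - 1) * (c - t)"
  \<comment> \<open>Back substitution: only \<open>e3\<close> has a k-part, which gives
    \<open>c\<close>; the j-part r = (c - \<phi> d)/2 then gives \<open>d\<close>.\<close>
  have t: "t = 2 * r" and c: "c = 2 * s"
    by (simp_all add: c_def t_def v_defs algebra_simps zphi_phi_mult sq)
  have d: "d = 2 * ((phi - 1) * (s - r))"
    by (simp add: d_def t c algebra_simps)
  have "x = qscale a e1 + qscale b e2 + qscale c e3 + qscale d e4"
    by (simp add: x c d e1_def e2_def e3_def e4_def qscale_def plus_quat_def one_quat_def)
      (simp add: a_def b_def v_defs algebra_simps zphi_phi_mult sq)
  \<comment> \<open>The entries \<open>p\<close>, \<open>q\<close>, \<open>r\<close>,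
    \<open>s\<close> may have denominator 2; in terms of the \<open>v\<close>s these halves have
    cancelled.\<close>
  moreover have "a \<in> zphi" "b \<in> zphi" "c \<in> zphi" "d \<in> zphi"
    unfolding a_def b_def d_def c_def t_def by (intro zphi_intros v)+
  ultimately show ?thesis
    unfolding icosians_def by blast
qed

lemma basis_mem_icosians: "e1 \<in> icosians" "e2 \<in> icosians" "e3 \<in> icosians" "e4 \<in> icosians"
proof -
  have [simp]: "qscale 0 y = 0" "qscale 1 y = y" for y :: "qsqrt5 quat"
    by (simp_all add: qscale_def zero_quat_def)
  have mem: "qscale a e1 + qscale b e2 + qscale c e3 + qscale d e4 \<in> icosians"
    if "a \<in> zphi" "b \<in> zphi" "c \<in> zphi" "d \<in> zphi" for a b c d
    using that unfolding icosians_def by blast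
  show "e1 \<in> icosians" "e2 \<in> icosians" "e3 \<in> icosians" "e4 \<in> icosians"
    using mem[of 1 0 0 0] mem[of 0 1 0 0] mem[of 0 0 1 0] mem[of 0 0 0 1]
    by (simp_all add: zphi_numeral)
qed

lemma zero_mem_icosians: "0 \<in> icosians"
  using icosians_Quat[of 0 0 0 0] by (simp add: zphi_numeral zero_quat_def)

lemma polar_dual_G0: "polar_dual G0 = G0"
proof (intro equalityI subsetI)
  fix x assume "x \<in> G0"
  then show "x \<in> polar_dual G0"
    by (auto simp: polar_dual_def G0_def opolar_Oct oscale_one_mem_zphi_oct_iff
        intro!: zphi_add qpolar_icosians_mem_zphi)
next
  fix x assume x: "x \<in> polar_dual G0"
  obtain a b where ab: "x = Oct a b"
    by (rule oct.exhaust)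
  have sum: "qpolar a c + qpolar b d \<in> zphi" if "c \<in> icosians" "d \<in> icosians" for c d
  proof -
    have "opolar (Oct a b) (Oct c d) \<in> zphi_oct"
      using x that unfolding ab polar_dual_def G0_def by blast
    then show ?thesis
      by (simp only: opolar_Oct oscale_one_mem_zphi_oct_iff)
  qed
  have [simp]: "qpolar y 0 = 0" for y :: "qsqrt5 quat"
    by (simp add: qpolar_def zero_quat_def)
  \<comment> \<open>Pairing with elements that vanish in one half isolates the other.\<close>
  have "qpolar a c \<in> zphi" "qpolar b c \<in> zphi" if "c \<in> icosians" for c
    using sum[OF that zero_mem_icosians] sum[OF zero_mem_icosians that] by simp_all
  then have "a \<in> icosians" "b \<in> icosians"
    by (auto intro!: mem_icosians_if_qpolar_basis basis_mem_icosians)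
  then show "x \<in> G0"
    by (simp add: ab G0_def)
qed

text \<open>For \<open>x\<close> in \<open>M\<close> and \<open>g\<close> in \<open>G\<close> the
  sum \<open>x + g\<close> stays in \<open>M\<close>, so all three norms in
  \<open>opolar x g\<close> are integral.\<close>

lemma norm_integral_subset_polar_dual:
  assumes "G \<subseteq> M" "\<And>x y. x \<in> M \<Longrightarrow> y \<in> M \<Longrightarrow> x + y \<in> M" "\<And>x. x \<in> M \<Longrightarrow> onorm2 x \<in> zphi_oct"
  shows "M \<subseteq> polar_dual G"
  using assms by (auto simp: polar_dual_def opolar_def intro!: zphi_oct_diff)

theorem proposition6p12:
  shows "polar_dual G0 = G0 \<and>
    \<not> (\<exists>M. strict_norm_integral_overorder G0 M \<and> adjoins_fractional_layer G0 M)"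
proof -
  have False if "strict_norm_integral_overorder G0 M" for M
  proof -
    have "G0 \<subset> M" "\<And>x y. x \<in> M \<Longrightarrow> y \<in> M \<Longrightarrow> x + y \<in> M" "\<And>x. x \<in> M \<Longrightarrow> onorm2 x \<in> zphi_oct"
      using that by (auto simp: strict_norm_integral_overorder_def zphi_order_def)
    \<comment> \<open>\<open>M\<close> is squeezed between \<open>G0\<close> and its dual, which is
      \<open>G0\<close> again, against strictness.\<close>
    then show False
      using norm_integral_subset_polar_dual[of G0 M] polar_dual_G0 by blast
  qed
  then show ?thesis
    using polar_dual_G0 by blast
qed

end
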